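(* Let $X$ be a (real) normed space with norm $\Vert\cdot\Vert$, and let $J:X\to X^*$ be a duality selection map, i.e. $\langle x,Jx\rangle=\Vert x\Vert^2=\Vert Jx\Vert^2$ for all $x\in X$. (a) If $J$ is norm-to-norm continuous, then $X$ is smooth. (b) If $J$ is norm-to-norm uniformly continuous on bounded subsets of $X$, then $X$ is uniformly smooth.
   Context: $X^*$ is the dual space of $X$ with the dual norm, and $\langle x,x^*\rangle$ denotes $x^*(x)$. $X$ is smooth if the limit $\lim_{t\to0}\frac{\Vert x+ty\Vert-\Vert x\Vert}{t}$ exists for all $x,y$ in the unit sphere of $X$ ($t$ ranging over nonzero reals), and uniformly smooth if moreover this limit is attained uniformly in $x,y$ in the unit sphere. *)

theory Defs
  imports "HOL-Analysis.Analysis"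
begin

text \<open>The dual space of \<open>'a\<close> is the type \<open>'a \<Rightarrow>\<^sub>L real\<close> with the operator norm.\<close>

definition duality_selection :: "('a::real_normed_vector \<Rightarrow> ('a \<Rightarrow>\<^sub>L real)) \<Rightarrow> bool" where
  "duality_selection J \<longleftrightarrow>
     (\<forall>x. blinfun_apply (J x) x = (norm x)\<^sup>2 \<and> (norm (J x))\<^sup>2 = (norm x)\<^sup>2)"

definition norm_quotient :: "real \<Rightarrow> 'a::real_normed_vector \<Rightarrow> 'a \<Rightarrow> real" where
  "norm_quotient t x y = (norm (x + t *\<^sub>R y) - norm x) / t"

definition smooth_space :: "'a::real_normed_vector itself \<Rightarrow> bool" where
  "smooth_space _ \<longleftrightarrow>
     (\<forall>x\<in>sphere (0::'a) 1. \<forall>y\<in>sphere (0::'a) 1.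
        \<exists>l. ((\<lambda>t. norm_quotient t x y) \<longlongrightarrow> l) (at 0))"

definition uniformly_smooth_space :: "'a::real_normed_vector itself \<Rightarrow> bool" where
  "uniformly_smooth_space T \<longleftrightarrow>
     smooth_space T \<and>
     uniform_limit (sphere (0::'a) 1 \<times> sphere (0::'a) 1)
       (\<lambda>t (x, y). norm_quotient t x y)
       (\<lambda>(x, y). Lim (at 0) (\<lambda>t. norm_quotient t x y)) (at 0)"

end

theory Submission imports Defs begin

text \<open>
  For unit vectors \<open>x\<close>, \<open>y\<close> put \<open>z = x + t y\<close>. Testing \<open>J x\<close> on \<open>z\<close> and \<open>J z\<close> on \<open>x\<close>
  gives \<open>t \<langle>y, J x\<rangle> \<le> \<parallel>z\<parallel> - 1\<close> and \<open>\<parallel>z\<parallel> (\<parallel>z\<parallel> - 1) \<le> t \<langle>y, J z\<rangle>\<close>. Hence the difference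
  quotient of the norm is within \<open>\<bar>t\<bar> + \<parallel>J z - J x\<parallel>\<close> of \<open>\<langle>y, J x\<rangle>\<close>, and (uniform)
  continuity of \<open>J\<close> becomes (uniform) convergence of the quotients.
\<close>

lemma norm_duality_selection:
  assumes "duality_selection J"
  shows "norm (J x) = norm x"
  using assms by (simp add: duality_selection_def)

lemma duality_selection_apply_self:
  assumes "duality_selection J"
  shows "blinfun_apply (J x) x = (norm x)\<^sup>2"
  using assms by (simp add: duality_selection_def)

lemma duality_selection_apply_le:
  assumes "duality_selection J"
  shows "blinfun_apply (J x) y \<le> norm x * norm y"
  using norm_blinfun[of "J x" y] by (simp add: norm_duality_selection[OF assms])

lemma norm_quotient_duality_bound:
  fixes J :: "'a::real_normed_vector \<Rightarrow> ('a \<Rightarrow>\<^sub>L real)"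
  assumes J: "duality_selection J" and x: "norm x = 1" and y: "norm y = 1" and t: "t \<noteq> 0"
  shows "\<bar>norm_quotient t x y - J x y\<bar> \<le> \<bar>t\<bar> + norm (J (x + t *\<^sub>R y) - J x)"
proof -
  define z where "z = x + t *\<^sub>R y"
  define q where "q = norm_quotient t x y"
  have tq: "t * q = norm z - 1"
    using t x by (simp add: q_def norm_quotient_def z_def)
  have lower: "t * J x y \<le> t * q"
    using duality_selection_apply_le[OF J, of x z] duality_selection_apply_self[OF J, of x] x
    by (simp add: tq z_def blinfun.add_right blinfun.scaleR_right)
  \<comment> \<open>The factor \<open>norm z\<close> stays on the left, since dividing by it would
    require \<open>z\<close> to be nonzero; the estimate \<open>a\<close> removes it later.\<close>
  have upper: "t * (norm z * q) \<le> t * J z y"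
  proof -
    have "J z x = (norm z)\<^sup>2 - t * J z y"
      using duality_selection_apply_self[OF J, of z]
      by (simp add: z_def blinfun.add_right blinfun.scaleR_right)
    then have "norm z * (norm z - 1) \<le> t * J z y"
      using duality_selection_apply_le[OF J, of z x] x
      by (simp add: power2_eq_square algebra_simps)
    then show ?thesis by (simp flip: tq add: mult.left_commute)
  qed
  have z1: "\<bar>norm z - 1\<bar> \<le> \<bar>t\<bar>"
    using norm_triangle_ineq3[of z x] x y by (simp add: z_def)
  then have q1: "\<bar>q\<bar> \<le> 1"
    using t by (simp flip: tq add: abs_mult)
  \<comment> \<open>This is the source of the term |t| in the bound: \<open>norm z\<close> is within
    |t| of 1 and \<open>q\<close> is at most 1 in absolute value, so dropping the factor
    \<open>norm z\<close> costs at most |t|.\<close>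
  have "\<bar>(norm z - 1) * q\<bar> \<le> \<bar>t\<bar> * 1"
    unfolding abs_mult by (intro mult_mono z1 q1) auto
  then have a: "\<bar>norm z * q - q\<bar> \<le> \<bar>t\<bar>"
    by (simp add: left_diff_distrib)
  have b: "\<bar>J z y - J x y\<bar> \<le> norm (J z - J x)"
    using norm_blinfun[of "J z - J x" y] y by (simp add: blinfun.diff_left)
  \<comment> \<open>The sign of \<open>t\<close> decides the direction of \<open>lower\<close> and
    \<open>upper\<close> after division. For positive \<open>t\<close>, \<open>q\<close> lies
    between \<open>J x y\<close> and \<open>J z y + |t|\<close>, and \<open>b\<close> compares
    \<open>J z y\<close> with \<open>J x y\<close>; for negative \<open>t\<close> the picture is
    mirrored.\<close>
  have "\<bar>q - J x y\<bar> \<le> \<bar>t\<bar> + norm (J z - J x)"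
  proof (cases "t > 0")
    case True
    then have "J x y \<le> q" "norm z * q \<le> J z y" using lower upper by auto
    then show ?thesis using a b by linarith
  next
    case False
    then have "J x y \<ge> q" "norm z * q \<ge> J z y" using lower upper t by auto
    then show ?thesis using a b by linarith
  qed
  then show ?thesis by (simp add: q_def z_def)
qed

text \<open>With the base point \<open>x\<close> fixed, both error terms vanish as
  \<open>x + t y\<close> tends to \<open>x\<close>, so \<open>J x\<close> is the directional
  derivative of the norm at \<open>x\<close>.\<close>

lemma tendsto_norm_quotient_duality:
  fixes J :: "'a::real_normed_vector \<Rightarrow> ('a \<Rightarrow>\<^sub>L real)"
  assumes J: "duality_selection J" and cont: "isCont J x" and x: "norm x = 1" and y: "norm y = 1"
  shows "((\<lambda>t. norm_quotient t x y) \<longlongrightarrow> J x y) (at 0)"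
proof (rule LIM_zero_cancel, rule Lim_null_comparison)
  show "\<forall>\<^sub>F t in at 0. norm (norm_quotient t x y - J x y) \<le> \<bar>t\<bar> + norm (J (x + t *\<^sub>R y) - J x)"
    using norm_quotient_duality_bound[OF J x y]
    by (auto simp: eventually_at_filter)
  have "((\<lambda>t. x + t *\<^sub>R y) \<longlongrightarrow> x) (at 0)"
    by (auto intro!: tendsto_eq_intros)
  from isCont_tendsto_compose[OF cont this]
  show "((\<lambda>t. \<bar>t\<bar> + norm (J (x + t *\<^sub>R y) - J x)) \<longlongrightarrow> 0) (at 0)"
    by (auto intro!: tendsto_eq_intros)
qed

text \<open>The ball of radius 2 contains \<open>x\<close> and \<open>x + t y\<close> for all unit
  vectors and |t| at most 1, so one modulus of continuity serves all pairs at once.\<close>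

lemma uniform_limit_norm_quotient_duality:
  fixes J :: "'a::real_normed_vector \<Rightarrow> ('a \<Rightarrow>\<^sub>L real)"
  assumes J: "duality_selection J" and uc: "uniformly_continuous_on (cball 0 2) J"
  shows "uniform_limit (sphere 0 1 \<times> sphere 0 1)
           (\<lambda>t (x, y). norm_quotient t x y) (\<lambda>(x, y). J x y) (at 0)"
proof (rule uniform_limitI)
  fix e :: real assume e: "e > 0"
  obtain d where d: "d > 0"
    "\<And>x z. x \<in> cball 0 2 \<Longrightarrow> z \<in> cball 0 2 \<Longrightarrow> dist z x < d \<Longrightarrow> dist (J z) (J x) < e / 2"
    using uc e unfolding uniformly_continuous_on_def by (metis half_gt_zero)
  \<comment> \<open>The three bounds on |t| have separate tasks: 1 keeps \<open>x + t y\<close> in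
    the ball, \<open>d\<close> makes the \<open>J\<close> term less than \<open>e / 2\<close>, and
    \<open>e / 2\<close> controls the term |t|.\<close>
  have "dist (norm_quotient t x y) (J x y) < e"
    if t: "t \<noteq> 0" "\<bar>t\<bar> < min 1 (min d (e / 2))" and x: "norm x = 1" and y: "norm y = 1" for t x y
  proof -
    have "norm (x + t *\<^sub>R y) \<le> 2"
      using norm_triangle_ineq[of x "t *\<^sub>R y"] t x y by simp
    moreover have "dist (x + t *\<^sub>R y) x < d"
      using t y by (simp add: dist_norm)
    ultimately have "dist (J (x + t *\<^sub>R y)) (J x) < e / 2"
      using x by (intro d(2)) auto
    then show ?thesis
      using norm_quotient_duality_bound[OF J x y t(1)] t by (simp add: dist_norm)
  qed
  moreover have "\<forall>\<^sub>F t in at (0::real). t \<noteq> 0 \<and> \<bar>t\<bar> < min 1 (min d (e / 2))"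
    unfolding eventually_at using d(1) e by (intro exI[of _ "min 1 (min d (e / 2))"]) auto
  ultimately show "\<forall>\<^sub>F t in at 0. \<forall>p\<in>sphere 0 1 \<times> sphere 0 1.
      dist (case p of (x, y) \<Rightarrow> norm_quotient t x y) (case p of (x, y) \<Rightarrow> J x y) < e"
    by (auto elim!: eventually_mono)
qed

theorem theorem4p1:
  fixes J :: "'a::real_normed_vector \<Rightarrow> ('a \<Rightarrow>\<^sub>L real)"
  assumes "duality_selection J"
  shows "(continuous_on UNIV J \<longrightarrow> smooth_space TYPE('a)) \<and>
         ((\<forall>B. bounded B \<longrightarrow> uniformly_continuous_on B J) \<longrightarrow> uniformly_smooth_space TYPE('a))"
proof (intro conjI impI)
  assume "continuous_on UNIV J"
  then have "isCont J x" for x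
    by (simp add: continuous_on_eq_continuous_at)
  then have "((\<lambda>t. norm_quotient t x y) \<longlongrightarrow> J x y) (at 0)"
    if "x \<in> sphere 0 1" "y \<in> sphere 0 1" for x y
    using that by (intro tendsto_norm_quotient_duality assms) auto
  then show "smooth_space TYPE('a)"
    unfolding smooth_space_def by (intro ballI exI)
next
  assume "\<forall>B. bounded B \<longrightarrow> uniformly_continuous_on B J"
  then have lim: "uniform_limit (sphere 0 1 \<times> sphere 0 1)
      (\<lambda>t (x, y). norm_quotient t x y) (\<lambda>(x, y). J x y) (at 0)"
    by (intro uniform_limit_norm_quotient_duality assms) auto
  have tendsto: "((\<lambda>t. norm_quotient t x y) \<longlongrightarrow> J x y) (at 0)"
    if "x \<in> sphere 0 1" "y \<in> sphere 0 1" for x y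
    using tendsto_uniform_limitI[OF lim, of "(x, y)"] that by simp
  \<comment> \<open>\<open>Lim\<close> is a definite description, so the pointwise limits, which
    uniform convergence supplies, must first identify its value before it can replace
    \<open>J x y\<close> in \<open>lim\<close>.\<close>
  then have "Lim (at 0) (\<lambda>t. norm_quotient t x y) = J x y"
    if "x \<in> sphere 0 1" "y \<in> sphere 0 1" for x y
    using that by (intro tendsto_Lim) auto
  then have "uniform_limit (sphere 0 1 \<times> sphere 0 1) (\<lambda>t (x, y). norm_quotient t x y)
      (\<lambda>(x, y). Lim (at 0) (\<lambda>t. norm_quotient t (x::'a) y)) (at 0)"
    by (intro uniform_limit_cong'[THEN iffD1, OF _ _ lim]) auto
  moreover have "smooth_space TYPE('a)"
    using tendsto unfolding smooth_space_def by (intro ballI exI)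
  ultimately show "uniformly_smooth_space TYPE('a)"
    by (simp add: uniformly_smooth_space_def)
qed

end
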